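(* Consider a finite chemical network with species set $V$, reaction set $R$, rates $(k^\rho)_{\rho\in R}$, linearized generator $A$, Lyapunov exponent $\lambda^*$ and deficiency rates $\kappa_\sigma=\sum_{\rho\in R:\ \sigma(\rho)=\sigma}(p(\rho)-1)k^\rho$, $\sigma\in V$. (i) Let $v^*$ be a normalized Lyapunov eigenvector, i.e. $Av^*=\lambda^*v^*$, $v^*_\sigma\ge 0$ for all $\sigma$, and $\sum_{\sigma\in V} v^*_\sigma=1$. Then $$\lambda^*=\sum_{\sigma\in V}\kappa_\sigma v^*_\sigma .$$ (ii) Assume that the network obtained by keeping only the $1$-$1$ reactions (those with $p(\rho)=1$) defines an irreducible, detailed-balanced continuous-time Markov chain on $V$ with unique stationary probability measure $(\pi^0_\sigma)_{\sigma\in V}$. For $\varepsilon>0$, replace $k^\rho$ by $\varepsilon k^\rho$ for every reaction $\rho$ with $p(\rho)\neq 1$, leaving the rates of the $1$-$1$ reactions unchanged, and let $\lambda^*(\varepsilon)$ be the Lyapunov exponent of the resulting network. Then, to leading order as $\varepsilon\to 0$, $$\lambda^*(\varepsilon)\sim \varepsilon\sum_{\sigma\in V}\kappa_\sigma\,\pi^0_\sigma ,\qquad\text{i.e.}\qquad \lim_{\varepsilon\to0^+}\frac{\lambda^*(\varepsilon)}{\varepsilon}=\sum_{\sigma\in V}\kappa_\sigma\pi^0_\sigma ,$$ where $\kappa_\sigma$ is computed with the original (unscaled) rates.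
   Context: Network: $V$ is a finite set of species and $R$ a finite set of reactions. Each reaction $\rho\in R$ has exactly one reactant $\sigma(\rho)\in V$, a rate $k^\rho>0$, and $p(\rho)\in\{0,1,2\}$ products, counted with multiplicity, all different from the reactant ($p=0$: degradation reaction; $p=1$: $1$-$1$ reaction; $p=2$: one-to-two reaction). Generator: let $\mathbb S_{\sigma,\rho}$ be $-1$ if $\sigma$ is the reactant of $\rho$, the multiplicity of $\sigma$ among the products of $\rho$ if $\sigma$ is a product, and $0$ otherwise. The linearized dynamics is $dX/dt=AX$ with $(Av)_\sigma=\sum_{\rho\in R}\mathbb S_{\sigma,\rho}k^\rho v_{\sigma(\rho)}$. Off-diagonal entries of $A$ are non-negative. Lyapunov exponent: $\lambda^*$ is the eigenvalue of $A$ with largest real part; by the Perron-Frobenius theorem it is real and admits an eigenvector with non-negative entries (a Lyapunov eigenvector). Detailed balance in (ii): with $k^0_{\sigma\to\sigma'}$ the total rate of $1$-$1$ reactions from $\sigma$ to $\sigma'$, one has $\pi^0_{\sigma}k^0_{\sigma\to\sigma'}=\pi^0_{\sigma'}k^0_{\sigma'\to\sigma}$ for all $\sigma\ne\sigma'$. *)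

theory Defs
  imports "HOL-Analysis.Analysis" "HOL-Library.Multiset"
begin

text \<open>The species set is the whole of a finite type \<open>'s\<close>; reactions are labels in a finite set,
  so distinct reactions may share reactant and products.\<close>

record ('s, 'r) network =
  reactions :: "'r set"
  reactant :: "'r \<Rightarrow> 's"
  products :: "'r \<Rightarrow> 's multiset"
  rate :: "'r \<Rightarrow> real"

definition wf_network :: "('s, 'r) network \<Rightarrow> bool" where
  "wf_network N \<longleftrightarrow>
     finite (reactions N) \<and>
     (\<forall>\<rho>\<in>reactions N. rate N \<rho> > 0 \<and> size (products N \<rho>) \<in> {0, 1, 2} \<and>
        reactant N \<rho> \<notin># products N \<rho>)"

definition stoich :: "('s, 'r) network \<Rightarrow> 's \<Rightarrow> 'r \<Rightarrow> real" where
  "stoich N \<sigma> \<rho> = (if \<sigma> = reactant N \<rho> then - 1 else real (count (products N \<rho>) \<sigma>))"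

definition generator :: "('s::finite, 'r) network \<Rightarrow> real ^ 's ^ 's" where
  "generator N = (\<chi> \<sigma> \<tau>. \<Sum>\<rho> | \<rho> \<in> reactions N \<and> reactant N \<rho> = \<tau>. stoich N \<sigma> \<rho> * rate N \<rho>)"

lemma generator_mult_vec:
  assumes "finite (reactions N)"
  shows "(generator N *v v) $ \<sigma> =
           (\<Sum>\<rho>\<in>reactions N. stoich N \<sigma> \<rho> * rate N \<rho> * v $ reactant N \<rho>)"
proof -
  have "(generator N *v v) $ \<sigma> =
      (\<Sum>\<tau>\<in>UNIV. \<Sum>\<rho> | \<rho> \<in> reactions N \<and> reactant N \<rho> = \<tau>.
         stoich N \<sigma> \<rho> * rate N \<rho> * v $ reactant N \<rho>)"
    by (simp add: generator_def matrix_vector_mult_def sum_distrib_right)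
  also have "\<dots> = (\<Sum>\<rho>\<in>reactions N. stoich N \<sigma> \<rho> * rate N \<rho> * v $ reactant N \<rho>)"
    using assms by (intro sum.group) auto
  finally show ?thesis .
qed

definition eigenvalue :: "'a::field ^ 'n ^ 'n \<Rightarrow> 'a \<Rightarrow> bool" where
  "eigenvalue A \<mu> \<longleftrightarrow> (\<exists>v. v \<noteq> 0 \<and> A *v v = \<mu> *s v)"

text \<open>The eigenvalue of largest real part among all complex eigenvalues. It is real by the
  Perron--Frobenius theorem, since the off-diagonal entries of the generator are non-negative;
  this is what makes the description below proper.\<close>

definition is_lyapunov_exponent :: "('s::finite, 'r) network \<Rightarrow> real \<Rightarrow> bool" where
  "is_lyapunov_exponent N l \<longleftrightarrow>
     eigenvalue (map_matrix complex_of_real (generator N)) (complex_of_real l) \<and>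
     (\<forall>\<mu>. eigenvalue (map_matrix complex_of_real (generator N)) \<mu> \<longrightarrow> Re \<mu> \<le> l)"

definition lyapunov_exponent :: "('s::finite, 'r) network \<Rightarrow> real" where
  "lyapunov_exponent N = (THE l. is_lyapunov_exponent N l)"

lemma lyapunov_exponent_eqI:
  assumes "is_lyapunov_exponent N l"
  shows "lyapunov_exponent N = l"
  unfolding lyapunov_exponent_def
proof (rule the_equality)
  fix l' assume "is_lyapunov_exponent N l'"
  with assms have "l' \<le> l" "l \<le> l'"
    unfolding is_lyapunov_exponent_def by fastforce+
  then show "l' = l" by simp
qed (fact assms)

definition normalized_lyapunov_eigenvector ::
    "('s::finite, 'r) network \<Rightarrow> real ^ 's \<Rightarrow> bool" where
  "normalized_lyapunov_eigenvector N v \<longleftrightarrow>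
     generator N *v v = lyapunov_exponent N *s v \<and> (\<forall>\<sigma>. v $ \<sigma> \<ge> 0) \<and> (\<Sum>\<sigma>\<in>UNIV. v $ \<sigma>) = 1"

definition deficiency_rate :: "('s, 'r) network \<Rightarrow> 's \<Rightarrow> real" where
  "deficiency_rate N \<sigma> =
     (\<Sum>\<rho> | \<rho> \<in> reactions N \<and> reactant N \<rho> = \<sigma>. (real (size (products N \<rho>)) - 1) * rate N \<rho>)"

definition one_one_rate :: "('s, 'r) network \<Rightarrow> 's \<Rightarrow> 's \<Rightarrow> real" where
  "one_one_rate N \<sigma> \<sigma>' =
     (\<Sum>\<rho> | \<rho> \<in> reactions N \<and> reactant N \<rho> = \<sigma> \<and> products N \<rho> = {#\<sigma>'#}. rate N \<rho>)"

definition scale_non_one_one :: "real \<Rightarrow> ('s, 'r) network \<Rightarrow> ('s, 'r) network" where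
  "scale_non_one_one \<epsilon> N =
     N\<lparr>rate := (\<lambda>\<rho>. if size (products N \<rho>) = 1 then rate N \<rho> else \<epsilon> * rate N \<rho>)\<rparr>"

text \<open>Continuous-time Markov chains on a finite type, given by their jump rates \<open>q \<sigma> \<sigma>'\<close>
  from \<open>\<sigma>\<close> to \<open>\<sigma>'\<close>; diagonal values of \<open>q\<close> are irrelevant.\<close>

definition irreducible_chain :: "('s \<Rightarrow> 's \<Rightarrow> real) \<Rightarrow> bool" where
  "irreducible_chain q \<longleftrightarrow> (\<forall>\<sigma> \<sigma>'. (\<sigma>, \<sigma>') \<in> {(a, b). a \<noteq> b \<and> q a b > 0}\<^sup>*)"

definition stationary_distribution ::
    "('s::finite \<Rightarrow> 's \<Rightarrow> real) \<Rightarrow> ('s \<Rightarrow> real) \<Rightarrow> bool" where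
  "stationary_distribution q \<pi> \<longleftrightarrow>
     (\<forall>\<sigma>. \<pi> \<sigma> \<ge> 0) \<and> (\<Sum>\<sigma>\<in>UNIV. \<pi> \<sigma>) = 1 \<and>
     (\<forall>\<sigma>. (\<Sum>\<sigma>'\<in>UNIV - {\<sigma>}. \<pi> \<sigma>' * q \<sigma>' \<sigma>) = \<pi> \<sigma> * (\<Sum>\<sigma>'\<in>UNIV - {\<sigma>}. q \<sigma> \<sigma>'))"

definition detailed_balanced :: "('s \<Rightarrow> 's \<Rightarrow> real) \<Rightarrow> ('s \<Rightarrow> real) \<Rightarrow> bool" where
  "detailed_balanced q \<pi> \<longleftrightarrow> (\<forall>\<sigma> \<sigma>'. \<sigma> \<noteq> \<sigma>' \<longrightarrow> \<pi> \<sigma> * q \<sigma> \<sigma>' = \<pi> \<sigma>' * q \<sigma>' \<sigma>)"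

end

theory Submission
  imports Defs
begin

text \<open>Summing the entries of a column of the generator gives the deficiency rate, so summing the
  eigenvector equation gives (i). For (ii), a fixed point of \<open>v \<mapsto> (A + c I) v / \<Sum> (A + c I) v\<close> on
  the probability simplex, which exists by Brouwer, is a positive eigenvector, and a weighted maximum
  norm shows that its eigenvalue is the Lyapunov exponent. The generator splits as \<open>A\<^sub>0 + \<epsilon> A\<^sub>1\<close>
  with \<open>A\<^sub>0\<close> the generator of the Markov chain; by (i) the exponent is \<open>\<epsilon> \<Sum> \<kappa> v\<^sub>\<epsilon>\<close>, hence
  \<open>A\<^sub>0 v\<^sub>\<epsilon> = O(\<epsilon>)\<close>, and by compactness of the simplex \<open>v\<^sub>\<epsilon>\<close> tends to the only zero \<open>\<pi>\<close> of
  \<open>A\<^sub>0\<close> there.\<close>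

section \<open>Perron-Frobenius theory for matrices with non-negative off-diagonal entries\<close>

definition prob_simplex :: "(real ^ 'n::finite) set" where
  "prob_simplex = {v. (\<forall>i. 0 \<le> v $ i) \<and> (\<Sum>i\<in>UNIV. v $ i) = 1}"

lemma compact_prob_simplex: "compact (prob_simplex :: (real ^ 'n::finite) set)"
proof -
  have "norm v \<le> 1" if "v \<in> prob_simplex" for v :: "real ^ 'n"
    using norm_le_l1_cart[of v] that by (simp add: prob_simplex_def)
  then have "bounded (prob_simplex :: (real ^ 'n) set)"
    unfolding bounded_iff by blast
  moreover have "closed (prob_simplex :: (real ^ 'n) set)"
    unfolding prob_simplex_def
    by (intro closed_Collect_conj closed_Collect_all closed_Collect_le closed_Collect_eq
        continuous_intros)
  ultimately show ?thesis
    by (simp add: compact_eq_bounded_closed)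
qed

lemma convex_prob_simplex: "convex (prob_simplex :: (real ^ 'n::finite) set)"
  unfolding convex_def prob_simplex_def
  by (auto simp: sum.distrib sum_distrib_left[symmetric])

lemma prob_simplex_nonempty: "(prob_simplex :: (real ^ 'n::finite) set) \<noteq> {}"
proof -
  have "(\<chi> i. 1 / real CARD('n)) \<in> (prob_simplex :: (real ^ 'n) set)"
    by (simp add: prob_simplex_def)
  then show ?thesis by blast
qed

text \<open>After adding a large multiple of the identity, the image of \<open>v\<close> in the
  simplex lies entrywise above \<open>v\<close>. Its entry sum is thus at least 1, so normalization
  is a continuous self-map; a fixed point is an eigenvector, and the shift is subtracted from its
  eigenvalue.\<close>

lemma metzler_nonneg_eigenvector:
  fixes B :: "real ^ 'n::finite ^ 'n"
  assumes off: "\<And>i j. i \<noteq> j \<Longrightarrow> 0 \<le> B $ i $ j"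
  obtains l v where "v \<in> prob_simplex" "B *v v = l *s v"
proof -
  \<comment> \<open>This shift outweighs any negative diagonal entry with 1 to spare, which bounds
    \<open>s v\<close> away from 0 on the whole simplex.\<close>
  define c where "c = 1 + (\<Sum>i\<in>UNIV. \<bar>B $ i $ i\<bar>)"
  have c: "1 \<le> B $ i $ i + c" for i
    using member_le_sum[of i UNIV "\<lambda>i. \<bar>B $ i $ i\<bar>"] by (simp add: c_def)
  define g where "g v = B *v v + c *s v" for v
  define s where "s v = (\<Sum>i\<in>UNIV. g v $ i)" for v
  define f where "f v = inverse (s v) *\<^sub>R g v" for v
  have ge: "v $ i \<le> g v $ i" if "v \<in> prob_simplex" for v i
  proof -
    have nn: "0 \<le> v $ j" for j
      using that by (simp add: prob_simplex_def)
    have "g v $ i = (\<Sum>j\<in>UNIV - {i}. B $ i $ j * v $ j) + (B $ i $ i + c) * v $ i"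
      by (simp add: g_def matrix_vector_mult_def sum.remove[of UNIV i] algebra_simps)
    moreover have "0 \<le> (\<Sum>j\<in>UNIV - {i}. B $ i $ j * v $ j)"
      by (intro sum_nonneg mult_nonneg_nonneg off nn) auto
    moreover have "1 * v $ i \<le> (B $ i $ i + c) * v $ i"
      by (intro mult_right_mono c nn)
    ultimately show ?thesis by simp
  qed
  have s1: "1 \<le> s v" if "v \<in> prob_simplex" for v
    using sum_mono[of UNIV "\<lambda>i. v $ i" "\<lambda>i. g v $ i"] ge[OF that] that
    by (simp add: s_def prob_simplex_def)
  have "f v \<in> prob_simplex" if "v \<in> prob_simplex" for v
  proof -
    have "0 \<le> g v $ i" for i
      using ge[OF that, of i] that by (auto simp: prob_simplex_def intro: order_trans)
    then show ?thesis
      using s1[OF that] by (simp add: prob_simplex_def f_def sum_distrib_left[symmetric] s_def[symmetric])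
  qed
  moreover have "continuous_on prob_simplex f"
  proof -
    have "continuous_on prob_simplex g"
      unfolding g_def scalar_mult_eq_scaleR
      by (intro continuous_intros matrix_vector_mult_linear_continuous_on)
    moreover from this have "continuous_on prob_simplex s"
      unfolding s_def by (intro continuous_intros)
    moreover have "\<forall>v\<in>prob_simplex. s v \<noteq> 0"
      using s1 by fastforce
    ultimately show ?thesis
      unfolding f_def by (intro continuous_intros) auto
  qed
  ultimately obtain v where v: "v \<in> prob_simplex" "f v = v"
    using brouwer[OF compact_prob_simplex convex_prob_simplex prob_simplex_nonempty, of f] by blast
  have "s v *\<^sub>R f v = g v"
    using s1[OF v(1)] by (simp add: f_def)
  then have "B *v v = (s v - c) *s v"
    by (simp add: v(2) g_def scalar_mult_eq_scaleR algebra_simps)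
  then show thesis
    using v(1) that by blast
qed

text \<open>Positivity spreads along edges: if \<open>v $ a\<close> and \<open>B $ b $ a\<close> are
  positive, row \<open>b\<close> of the eigenvector equation has a positive off-diagonal sum, which
  \<open>v $ b = 0\<close> would contradict. Normalization supplies a positive entry to start from,
  and irreducibility reaches all others.\<close>

lemma irreducible_eigenvector_pos:
  fixes B :: "real ^ 'n::finite ^ 'n"
  assumes off: "\<And>i j. i \<noteq> j \<Longrightarrow> 0 \<le> B $ i $ j"
    and irr: "irreducible_chain (\<lambda>j i. B $ i $ j)"
    and v: "v \<in> prob_simplex" and eig: "B *v v = l *s v"
  shows "0 < v $ i"
proof -
  have nn: "0 \<le> v $ j" for j
    using v by (simp add: prob_simplex_def)
  have "\<exists>j. v $ j \<noteq> 0"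
    by (rule ccontr) (use v in \<open>simp add: prob_simplex_def\<close>)
  then obtain j where j: "0 < v $ j"
    using nn by (metis less_eq_real_def)
  have "(j, i) \<in> {(a, b). a \<noteq> b \<and> 0 < B $ b $ a}\<^sup>*"
    using irr by (simp add: irreducible_chain_def)
  then show ?thesis
  proof (induction rule: rtrancl_induct)
    case base
    show ?case by (fact j)
  next
    case (step a b)
    have "l * v $ b = B $ b $ b * v $ b + (\<Sum>k\<in>UNIV - {b}. B $ b $ k * v $ k)"
      using arg_cong[OF eig, of "\<lambda>x. x $ b"]
      by (simp add: matrix_vector_mult_def sum.remove[of UNIV b])
    moreover have "0 < (\<Sum>k\<in>UNIV - {b}. B $ b $ k * v $ k)"
      using step nn by (intro sum_pos2[of _ a] mult_nonneg_nonneg off) auto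
    ultimately have "v $ b \<noteq> 0" by auto
    then show ?case
      using nn[of b] by linarith
  qed
qed

text \<open>Compare moduli at an index maximizing \<open>cmod (x $ i) / v $ i\<close>.\<close>

lemma metzler_pos_eigenvector_dominates:
  fixes B :: "real ^ 'n::finite ^ 'n"
  assumes off: "\<And>i j. i \<noteq> j \<Longrightarrow> 0 \<le> B $ i $ j"
    and pos: "\<And>i. 0 < v $ i" and eig: "B *v v = l *s v"
    and \<mu>: "eigenvalue (map_matrix complex_of_real B) \<mu>"
  shows "Re \<mu> \<le> l"
proof -
  obtain x where x: "x \<noteq> 0" "map_matrix complex_of_real B *v x = \<mu> *s x"
    using \<mu> by (auto simp: eigenvalue_def)
  define m where "m = Max (range (\<lambda>i. cmod (x $ i) / v $ i))"
  have "m \<in> range (\<lambda>i. cmod (x $ i) / v $ i)"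
    unfolding m_def by (intro Max_in) auto
  then obtain i where i: "m = cmod (x $ i) / v $ i" by blast
  have le: "cmod (x $ j) \<le> m * v $ j" for j
  proof -
    have "cmod (x $ j) / v $ j \<le> m"
      unfolding m_def by (intro Max_ge) auto
    then show ?thesis
      using pos[of j] by (simp add: field_simps)
  qed
  obtain j where "x $ j \<noteq> 0"
    using x(1) by (auto simp: vec_eq_iff)
  then have "0 < m * v $ j"
    using le[of j] by (meson order_less_le_trans zero_less_norm_iff)
  then have m: "0 < m"
    using pos[of j] by (simp add: zero_less_mult_iff)
  have xi: "cmod (x $ i) = m * v $ i"
    using pos[of i] by (simp add: i)
  have "\<mu> * x $ i = B $ i $ i * x $ i + (\<Sum>k\<in>UNIV - {i}. B $ i $ k * x $ k)"
    using arg_cong[OF x(2), of "\<lambda>y. y $ i"]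
    by (simp add: matrix_vector_mult_def map_matrix_def sum.remove[of UNIV i])
  \<comment> \<open>Diagonal entries may be negative, so they are moved to the left before moduli
    are taken.\<close>
  then have "(\<mu> - B $ i $ i) * x $ i = (\<Sum>k\<in>UNIV - {i}. B $ i $ k * x $ k)"
    by (simp add: algebra_simps)
  then have "cmod (\<mu> - B $ i $ i) * cmod (x $ i) = cmod (\<Sum>k\<in>UNIV - {i}. B $ i $ k * x $ k)"
    by (metis norm_mult)
  \<comment> \<open>Non-negative off-diagonal entries pass through the modulus unchanged, and
    \<open>m * v\<close> dominates the moduli of the entries of \<open>x\<close>, with equality at
    \<open>i\<close>.\<close>
  also have "\<dots> \<le> (\<Sum>k\<in>UNIV - {i}. B $ i $ k * (m * v $ k))"
    using off le by (intro sum_norm_le) (auto simp: norm_mult intro!: mult_mono)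
  also have "\<dots> = m * (\<Sum>k\<in>UNIV - {i}. B $ i $ k * v $ k)"
    by (simp add: sum_distrib_left algebra_simps)
  also have "(\<Sum>k\<in>UNIV - {i}. B $ i $ k * v $ k) = (l - B $ i $ i) * v $ i"
    using arg_cong[OF eig, of "\<lambda>y. y $ i"]
    by (simp add: matrix_vector_mult_def sum.remove[of UNIV i] algebra_simps)
  finally have "cmod (\<mu> - B $ i $ i) * (m * v $ i) \<le> (l - B $ i $ i) * (m * v $ i)"
    by (simp add: xi algebra_simps)
  \<comment> \<open>This is a disc centred at the diagonal entry, with rightmost point
    \<open>l\<close>.\<close>
  then have "cmod (\<mu> - B $ i $ i) \<le> l - B $ i $ i"
    using m pos[of i] by simp
  then show ?thesis
    using complex_Re_le_cmod[of "\<mu> - B $ i $ i"] by simp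
qed

section \<open>Column sums of the generator and the Lyapunov exponent\<close>

lemma generator_off_diagonal_nonneg:
  assumes "wf_network N" "\<sigma> \<noteq> \<tau>"
  shows "0 \<le> generator N $ \<sigma> $ \<tau>"
  using assms by (auto simp: generator_def wf_network_def stoich_def less_imp_le intro!: sum_nonneg)

text \<open>A reaction removes one molecule and creates \<open>size (products N \<rho>)\<close>, so
  its stoichiometric column sums to \<open>p - 1\<close>; exchanging the two sums transfers this to
  the generator.\<close>

lemma generator_column_sum:
  assumes "wf_network N"
  shows "(\<Sum>\<sigma>\<in>UNIV. generator N $ \<sigma> $ \<tau>) = deficiency_rate N \<tau>"
proof -
  have "(\<Sum>\<sigma>\<in>UNIV. stoich N \<sigma> \<rho>) = real (size (products N \<rho>)) - 1" if "\<rho> \<in> reactions N" for \<rho>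
  proof -
    have r: "reactant N \<rho> \<notin># products N \<rho>"
      using assms that by (simp add: wf_network_def)
    have "(\<Sum>\<sigma>\<in>UNIV. stoich N \<sigma> \<rho>) =
        - 1 + (\<Sum>\<sigma>\<in>UNIV - {reactant N \<rho>}. real (count (products N \<rho>) \<sigma>))"
      by (simp add: stoich_def sum.remove[of UNIV "reactant N \<rho>"])
    \<comment> \<open>The reactant is absent from the products, so leaving out its index loses
      nothing from the count.\<close>
    also have "(\<Sum>\<sigma>\<in>UNIV - {reactant N \<rho>}. real (count (products N \<rho>) \<sigma>)) =
        (\<Sum>\<sigma>\<in>set_mset (products N \<rho>). real (count (products N \<rho>) \<sigma>))"
      using r by (intro sum.mono_neutral_right) (auto simp: count_eq_zero_iff)
    finally show ?thesis
      by (simp add: size_multiset_overloaded_eq)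
  qed
  moreover have "(\<Sum>\<sigma>\<in>UNIV. generator N $ \<sigma> $ \<tau>) =
      (\<Sum>\<rho> | \<rho> \<in> reactions N \<and> reactant N \<rho> = \<tau>. (\<Sum>\<sigma>\<in>UNIV. stoich N \<sigma> \<rho>) * rate N \<rho>)"
    by (simp add: generator_def sum_distrib_right) (rule sum.swap)
  ultimately show ?thesis
    by (simp add: deficiency_rate_def)
qed

text \<open>Adding up all rows pairs the equation with the all-ones vector. The form with a free
  \<open>l\<close> serves both (i) and the scaled network.\<close>

lemma eigenvalue_eq_sum_deficiency:
  assumes "wf_network N" "generator N *v v = l *s v" "(\<Sum>\<sigma>\<in>UNIV. v $ \<sigma>) = 1"
  shows "l = (\<Sum>\<sigma>\<in>UNIV. deficiency_rate N \<sigma> * v $ \<sigma>)"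
proof -
  have "l = (\<Sum>\<sigma>\<in>UNIV. (l *s v) $ \<sigma>)"
    by (simp add: sum_distrib_left[symmetric] assms(3))
  also have "\<dots> = (\<Sum>\<sigma>\<in>UNIV. \<Sum>\<tau>\<in>UNIV. generator N $ \<sigma> $ \<tau> * v $ \<tau>)"
    by (simp add: assms(2)[symmetric] matrix_vector_mult_def)
  also have "\<dots> = (\<Sum>\<tau>\<in>UNIV. (\<Sum>\<sigma>\<in>UNIV. generator N $ \<sigma> $ \<tau>) * v $ \<tau>)"
    by (subst sum.swap) (simp add: sum_distrib_right)
  finally show ?thesis
    by (simp add: generator_column_sum[OF assms(1)])
qed

text \<open>Irreducibility makes the fixed-point eigenvector positive, and a positive eigenvector
  bounds the real part of every complex eigenvalue. This identifies the value of the description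
  \<open>lyapunov_exponent N\<close>.\<close>

lemma irreducible_lyapunov_eigenvector:
  assumes wf: "wf_network N" and irr: "irreducible_chain (\<lambda>\<tau> \<sigma>. generator N $ \<sigma> $ \<tau>)"
  obtains v where "v \<in> prob_simplex" "generator N *v v = lyapunov_exponent N *s v"
proof -
  let ?B = "generator N"
  note off = generator_off_diagonal_nonneg[OF wf]
  obtain l v where v: "v \<in> prob_simplex" "?B *v v = l *s v"
    by (rule metzler_nonneg_eigenvector[of ?B, OF off])
  have pos: "0 < v $ i" for i
    using irreducible_eigenvector_pos[OF off irr v] .
  have "is_lyapunov_exponent N l"
    unfolding is_lyapunov_exponent_def
  proof (intro conjI allI impI)
    \<comment> \<open>The exponent is defined through the complex spectrum, so the real eigenvector
      is embedded entrywise.\<close>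
    let ?x = "\<chi> i. complex_of_real (v $ i)"
    have "?x \<noteq> 0"
      using pos by (auto simp: vec_eq_iff) (metis less_irrefl)
    moreover have "(map_matrix complex_of_real ?B *v ?x) $ i = (complex_of_real l *s ?x) $ i" for i
    proof -
      have "(map_matrix complex_of_real ?B *v ?x) $ i = complex_of_real ((?B *v v) $ i)"
        by (simp add: matrix_vector_mult_def map_matrix_def)
      then show ?thesis by (simp add: v(2))
    qed
    ultimately show "eigenvalue (map_matrix complex_of_real ?B) (complex_of_real l)"
      unfolding eigenvalue_def vec_eq_iff[of "_ *v _"] by blast
  qed (use metzler_pos_eigenvector_dominates[OF off pos v(2)] in blast)
  then show thesis
    using that v by (simp add: lyapunov_exponent_eqI)
qed

section \<open>Splitting off the 1-1 reactions and their Markov chain\<close>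

text \<open>Both parts are kept as networks with the original rates, so that the facts on generators
  apply to them directly.\<close>

definition one_one_part :: "('s, 'r) network \<Rightarrow> ('s, 'r) network" where
  "one_one_part N = N\<lparr>reactions := {\<rho> \<in> reactions N. size (products N \<rho>) = 1}\<rparr>"

definition non_one_one_part :: "('s, 'r) network \<Rightarrow> ('s, 'r) network" where
  "non_one_one_part N = N\<lparr>reactions := {\<rho> \<in> reactions N. size (products N \<rho>) \<noteq> 1}\<rparr>"

lemma wf_one_one_part: "wf_network N \<Longrightarrow> wf_network (one_one_part N)"
  by (simp add: wf_network_def one_one_part_def)

lemma wf_non_one_one_part: "wf_network N \<Longrightarrow> wf_network (non_one_one_part N)"
  by (auto simp: wf_network_def non_one_one_part_def)

lemma wf_scale_non_one_one: "wf_network N \<Longrightarrow> 0 < \<epsilon> \<Longrightarrow> wf_network (scale_non_one_one \<epsilon> N)"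
  by (simp add: wf_network_def scale_non_one_one_def)

lemma deficiency_rate_scale_non_one_one:
  "deficiency_rate (scale_non_one_one \<epsilon> N) \<sigma> = \<epsilon> * deficiency_rate N \<sigma>"
  by (auto simp: deficiency_rate_def scale_non_one_one_def sum_distrib_left intro!: sum.cong)

text \<open>The generator is linear in the rates, and the stoichiometry does not involve them, so
  the perturbation is exactly linear in \<epsilon>.\<close>

lemma generator_scale_non_one_one:
  fixes N :: "('s::finite, 'r) network"
  assumes "wf_network N"
  shows "generator (scale_non_one_one \<epsilon> N) =
    generator (one_one_part N) + \<epsilon> *\<^sub>R generator (non_one_one_part N)"
proof -
  have "generator (scale_non_one_one \<epsilon> N) $ \<sigma> $ \<tau> =
    generator (one_one_part N) $ \<sigma> $ \<tau> + \<epsilon> * generator (non_one_one_part N) $ \<sigma> $ \<tau>" for \<sigma> \<tau>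
  proof -
    let ?R = "{\<rho> \<in> reactions N. reactant N \<rho> = \<tau>}"
    let ?w = "\<lambda>\<rho>. stoich N \<sigma> \<rho> * rate N \<rho>"
    let ?one = "\<lambda>\<rho>. size (products N \<rho>) = 1"
    have fin: "finite ?R"
      using assms by (simp add: wf_network_def)
    have "generator (scale_non_one_one \<epsilon> N) $ \<sigma> $ \<tau> =
        (\<Sum>\<rho>\<in>?R. if ?one \<rho> then ?w \<rho> else \<epsilon> * ?w \<rho>)"
      by (auto simp: generator_def scale_non_one_one_def stoich_def intro!: sum.cong)
    also have "\<dots> = sum ?w {\<rho> \<in> ?R. ?one \<rho>} + \<epsilon> * sum ?w {\<rho> \<in> ?R. \<not> ?one \<rho>}"
      using fin by (simp add: sum.If_cases sum_distrib_left Int_def)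
    also have "sum ?w {\<rho> \<in> ?R. ?one \<rho>} = generator (one_one_part N) $ \<sigma> $ \<tau>"
      by (auto simp: generator_def one_one_part_def stoich_def intro!: sum.cong)
    also have "sum ?w {\<rho> \<in> ?R. \<not> ?one \<rho>} = generator (non_one_one_part N) $ \<sigma> $ \<tau>"
      by (auto simp: generator_def non_one_one_part_def stoich_def intro!: sum.cong)
    finally show ?thesis .
  qed
  then show ?thesis by (simp add: vec_eq_iff)
qed

text \<open>A product multiset of size one contributes to row \<sigma> only if it is
  \<open>{#\<sigma>#}\<close>. The indices swap because the generator has the reactant as column
  while a jump rate lists its source first.\<close>

lemma generator_one_one_part:
  assumes "wf_network N" "\<sigma> \<noteq> \<tau>"
  shows "generator (one_one_part N) $ \<sigma> $ \<tau> = one_one_rate N \<tau> \<sigma>"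
proof -
  have fin: "finite {\<rho> \<in> reactions N. size (products N \<rho>) = 1 \<and> reactant N \<rho> = \<tau>}"
    using assms(1) by (simp add: wf_network_def)
  have "generator (one_one_part N) $ \<sigma> $ \<tau> =
      (\<Sum>\<rho> | \<rho> \<in> reactions N \<and> size (products N \<rho>) = 1 \<and> reactant N \<rho> = \<tau>.
         real (count (products N \<rho>) \<sigma>) * rate N \<rho>)"
    using assms(2) by (auto simp: generator_def one_one_part_def stoich_def intro!: sum.cong)
  also have "\<dots> = (\<Sum>\<rho> | \<rho> \<in> reactions N \<and> reactant N \<rho> = \<tau> \<and> products N \<rho> = {#\<sigma>#}.
         real (count (products N \<rho>) \<sigma>) * rate N \<rho>)"
    using fin by (intro sum.mono_neutral_right)
      (auto split: if_splits dest!: size_1_singleton_mset[unfolded One_nat_def])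
  finally show ?thesis
    by (simp add: one_one_rate_def)
qed

text \<open>Every reaction kept has deficiency zero, so each column sums to zero and the diagonal
  balances the outflow.\<close>

lemma generator_one_one_part_diagonal:
  assumes "wf_network N"
  shows "generator (one_one_part N) $ \<sigma> $ \<sigma> = - (\<Sum>\<sigma>'\<in>UNIV - {\<sigma>}. one_one_rate N \<sigma> \<sigma>')"
proof -
  have "deficiency_rate (one_one_part N) \<sigma> = 0"
    by (simp add: deficiency_rate_def one_one_part_def)
  then have "(\<Sum>\<sigma>'\<in>UNIV. generator (one_one_part N) $ \<sigma>' $ \<sigma>) = 0"
    by (simp add: generator_column_sum wf_one_one_part assms)
  moreover have "(\<Sum>\<sigma>'\<in>UNIV - {\<sigma>}. generator (one_one_part N) $ \<sigma>' $ \<sigma>) =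
      (\<Sum>\<sigma>'\<in>UNIV - {\<sigma>}. one_one_rate N \<sigma> \<sigma>')"
    by (intro sum.cong) (auto simp: generator_one_one_part[OF assms])
  ultimately show ?thesis
    by (simp add: sum.remove[of UNIV \<sigma>])
qed

text \<open>Row \<sigma> of the product is inflow minus outflow at \<sigma>. Uniqueness of the
  stationary measure thereby becomes uniqueness of a zero on the simplex.\<close>

lemma stationary_distribution_iff_generator:
  assumes "wf_network N"
  shows "stationary_distribution (one_one_rate N) (\<lambda>\<sigma>. v $ \<sigma>) \<longleftrightarrow>
    v \<in> prob_simplex \<and> generator (one_one_part N) *v v = 0"
proof -
  have "(generator (one_one_part N) *v v) $ \<sigma> =
      (\<Sum>\<sigma>'\<in>UNIV - {\<sigma>}. v $ \<sigma>' * one_one_rate N \<sigma>' \<sigma>) -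
      v $ \<sigma> * (\<Sum>\<sigma>'\<in>UNIV - {\<sigma>}. one_one_rate N \<sigma> \<sigma>')" for \<sigma>
  proof -
    have "(\<Sum>\<sigma>'\<in>UNIV - {\<sigma>}. generator (one_one_part N) $ \<sigma> $ \<sigma>' * v $ \<sigma>') =
        (\<Sum>\<sigma>'\<in>UNIV - {\<sigma>}. v $ \<sigma>' * one_one_rate N \<sigma>' \<sigma>)"
      by (intro sum.cong) (auto simp: generator_one_one_part[OF assms])
    then show ?thesis
      by (simp add: matrix_vector_mult_def sum.remove[of UNIV \<sigma>]
          generator_one_one_part_diagonal[OF assms])
  qed
  then show ?thesis
    by (auto simp: stationary_distribution_def prob_simplex_def vec_eq_iff)
qed

section \<open>Convergence of the eigenvectors and the scaling limit\<close>

text \<open>Raising rates can only add edges. This carries irreducibility from the 1-1 chain to the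
  scaled generator.\<close>

lemma irreducible_chain_mono:
  assumes "irreducible_chain q" and "\<And>a b. a \<noteq> b \<Longrightarrow> q a b \<le> q' a b"
  shows "irreducible_chain q'"
proof -
  have "{(a, b). a \<noteq> b \<and> q a b > 0} \<subseteq> {(a, b). a \<noteq> b \<and> q' a b > 0}"
    using assms(2) by (auto intro: order_less_le_trans)
  then show ?thesis
    using assms(1) rtrancl_mono unfolding irreducible_chain_def by blast
qed

text \<open>Off any neighbourhood of \<open>a\<close>, the norm of \<open>g\<close> has a positive
  minimum on the compact remainder of \<open>K\<close>, so small values of \<open>g\<close> force
  \<open>u t\<close> into the neighbourhood.\<close>

lemma tendsto_unique_zero_compact:
  fixes g :: "'a::metric_space \<Rightarrow> 'b::real_normed_vector"
  assumes K: "compact K" and g: "continuous_on K g"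
    and zero: "\<And>x. x \<in> K \<Longrightarrow> g x = 0 \<Longrightarrow> x = a"
    and mem: "\<forall>\<^sub>F t in F. u t \<in> K" and lim: "((\<lambda>t. g (u t)) \<longlongrightarrow> 0) F"
  shows "(u \<longlongrightarrow> a) F"
proof (rule topological_tendstoI)
  fix U assume U: "open U" "a \<in> U"
  show "\<forall>\<^sub>F t in F. u t \<in> U"
  proof (cases "K - U = {}")
    case True
    then show ?thesis
      using mem by (auto elim: eventually_mono)
  next
    case False
    have "compact (K - U)"
      using K U(1) by (rule compact_diff)
    moreover have "continuous_on (K - U) (\<lambda>x. norm (g x))"
      using g by (intro continuous_intros) (auto intro: continuous_on_subset)
    ultimately obtain x where x: "x \<in> K - U" "\<And>y. y \<in> K - U \<Longrightarrow> norm (g x) \<le> norm (g y)"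
      using continuous_attains_inf[of "K - U"] False by blast
    have "0 < norm (g x)"
      using x(1) zero U(2) by auto
    then have "\<forall>\<^sub>F t in F. norm (g (u t)) < norm (g x)"
      using order_tendstoD(2)[OF tendsto_norm_zero[OF lim]] by blast
    with mem show ?thesis
      by eventually_elim (use x(2) in fastforce)
  qed
qed

text \<open>Scaling multiplies all deficiency rates by \<epsilon>, so the summed eigenvector
  equation puts this factor in the exponent and hence in the residual of the unperturbed equation.
  Both identities are exact for each \<epsilon>, with no expansion of eigenvalues.\<close>

lemma scaled_lyapunov_eigenvector:
  assumes wf: "wf_network N" and irr: "irreducible_chain (one_one_rate N)" and \<epsilon>: "0 < \<epsilon>"
  obtains v where "v \<in> prob_simplex"
    "lyapunov_exponent (scale_non_one_one \<epsilon> N) = \<epsilon> * (\<Sum>\<sigma>\<in>UNIV. deficiency_rate N \<sigma> * v $ \<sigma>)"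
    "generator (one_one_part N) *v v = \<epsilon> *\<^sub>R ((\<Sum>\<sigma>\<in>UNIV. deficiency_rate N \<sigma> * v $ \<sigma>) *\<^sub>R v
       - generator (non_one_one_part N) *v v)"
proof -
  let ?N = "scale_non_one_one \<epsilon> N"
  note wf' = wf_scale_non_one_one[OF wf \<epsilon>]
  \<comment> \<open>The other reactions add only non-negative off-diagonal entries, so every edge of
    the chain survives.\<close>
  have le: "one_one_rate N \<tau> \<sigma> \<le> generator ?N $ \<sigma> $ \<tau>" if "\<tau> \<noteq> \<sigma>" for \<sigma> \<tau>
    using that \<epsilon> generator_off_diagonal_nonneg[OF wf_non_one_one_part[OF wf]]
    by (simp add: generator_scale_non_one_one[OF wf] generator_one_one_part[OF wf])
  have "irreducible_chain (\<lambda>\<tau> \<sigma>. generator ?N $ \<sigma> $ \<tau>)"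
    by (rule irreducible_chain_mono[OF irr]) (rule le)
  then obtain v where v: "v \<in> prob_simplex" "generator ?N *v v = lyapunov_exponent ?N *s v"
    using irreducible_lyapunov_eigenvector[OF wf'] by blast
  have l: "lyapunov_exponent ?N = \<epsilon> * (\<Sum>\<sigma>\<in>UNIV. deficiency_rate N \<sigma> * v $ \<sigma>)"
    using eigenvalue_eq_sum_deficiency[OF wf' v(2)] v(1)
    by (simp add: prob_simplex_def deficiency_rate_scale_non_one_one sum_distrib_left algebra_simps)
  let ?k = "\<Sum>\<sigma>\<in>UNIV. deficiency_rate N \<sigma> * v $ \<sigma>"
  have "generator (one_one_part N) *v v + \<epsilon> *\<^sub>R (generator (non_one_one_part N) *v v) = (\<epsilon> * ?k) *\<^sub>R v"
    using v(2)
    by (simp only: generator_scale_non_one_one[OF wf] l matrix_vector_mult_add_rdistrib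
        scaleR_matrix_vector_assoc scalar_mult_eq_scaleR)
  then have "generator (one_one_part N) *v v =
      \<epsilon> *\<^sub>R (?k *\<^sub>R v - generator (non_one_one_part N) *v v)"
    by (simp add: scaleR_diff_right eq_diff_eq)
  then show thesis
    using that v(1) l by blast
qed

lemma lyapunov_exponent_scaling_limit:
  fixes N :: "('s::finite, 'r) network"
  assumes wf: "wf_network N" and irr: "irreducible_chain (one_one_rate N)"
    and unique: "\<And>\<pi>'. stationary_distribution (one_one_rate N) \<pi>' \<Longrightarrow> \<pi>' = \<pi>"
  shows "((\<lambda>\<epsilon>. lyapunov_exponent (scale_non_one_one \<epsilon> N) / \<epsilon>)
           \<longlongrightarrow> (\<Sum>\<sigma>\<in>UNIV. deficiency_rate N \<sigma> * \<pi> \<sigma>)) (at_right 0)"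
proof -
  define A0 where "A0 = generator (one_one_part N)"
  define \<kappa> where "\<kappa> v = (\<Sum>\<sigma>\<in>UNIV. deficiency_rate N \<sigma> * v $ \<sigma>)" for v :: "real ^ 's"
  define h where "h v = \<kappa> v *\<^sub>R v - generator (non_one_one_part N) *v v" for v :: "real ^ 's"
  have "\<exists>v. v \<in> prob_simplex \<and> lyapunov_exponent (scale_non_one_one \<epsilon> N) = \<epsilon> * \<kappa> v \<and>
      A0 *v v = \<epsilon> *\<^sub>R h v" if "0 < \<epsilon>" for \<epsilon>
    unfolding A0_def \<kappa>_def h_def
    by (rule scaled_lyapunov_eigenvector[OF wf irr that]) blast
  \<comment> \<open>An eigenvector is chosen separately for each positive \<epsilon>; convergence
    will come from compactness, not from regularity of this choice.\<close>
  then obtain u where u: "\<And>\<epsilon>. 0 < \<epsilon> \<Longrightarrow> u \<epsilon> \<in> prob_simplex"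
    "\<And>\<epsilon>. 0 < \<epsilon> \<Longrightarrow> lyapunov_exponent (scale_non_one_one \<epsilon> N) = \<epsilon> * \<kappa> (u \<epsilon>)"
    "\<And>\<epsilon>. 0 < \<epsilon> \<Longrightarrow> A0 *v u \<epsilon> = \<epsilon> *\<^sub>R h (u \<epsilon>)"
    by metis
  have pos: "\<forall>\<^sub>F \<epsilon>::real in at_right 0. 0 < \<epsilon>"
    by (simp add: eventually_at_right_less)
  have "continuous_on prob_simplex h"
    unfolding h_def \<kappa>_def by (intro continuous_intros matrix_vector_mult_linear_continuous_on)
  then have "bounded (h ` prob_simplex)"
    using compact_prob_simplex compact_continuous_image compact_imp_bounded by blast
  \<comment> \<open>\<open>C\<close> is independent of \<epsilon>, so the residual
    \<open>A0 *v u \<epsilon>\<close> is at most a constant times \<epsilon>.\<close>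
  then obtain C where C: "\<And>v. v \<in> prob_simplex \<Longrightarrow> norm (h v) \<le> C"
    unfolding bounded_iff by blast
  have lim: "((\<lambda>\<epsilon>. A0 *v u \<epsilon>) \<longlongrightarrow> 0) (at_right 0)"
  proof (rule Lim_null_comparison)
    show "\<forall>\<^sub>F \<epsilon> in at_right 0. norm (A0 *v u \<epsilon>) \<le> \<epsilon> * C"
      using pos by eventually_elim (simp add: u C)
    show "((\<lambda>\<epsilon>. \<epsilon> * C) \<longlongrightarrow> 0) (at_right 0)"
      by (auto intro!: tendsto_eq_intros)
  qed
  have zero: "v = (\<chi> \<sigma>. \<pi> \<sigma>)" if "v \<in> prob_simplex" "A0 *v v = 0" for v
  proof -
    have "(\<lambda>\<sigma>. v $ \<sigma>) = \<pi>"
      using that unique by (simp add: A0_def stationary_distribution_iff_generator[OF wf])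
    then show ?thesis by auto
  qed
  have mem: "\<forall>\<^sub>F \<epsilon> in at_right 0. u \<epsilon> \<in> prob_simplex"
    using pos by eventually_elim (simp add: u)
  have "(u \<longlongrightarrow> (\<chi> \<sigma>. \<pi> \<sigma>)) (at_right 0)"
    by (rule tendsto_unique_zero_compact[OF compact_prob_simplex
        matrix_vector_mult_linear_continuous_on _ mem lim]) (rule zero)
  then have "((\<lambda>\<epsilon>. \<kappa> (u \<epsilon>)) \<longlongrightarrow> \<kappa> (\<chi> \<sigma>. \<pi> \<sigma>)) (at_right 0)"
    unfolding \<kappa>_def by (intro tendsto_intros)
  moreover have "\<forall>\<^sub>F \<epsilon> in at_right 0. \<kappa> (u \<epsilon>) = lyapunov_exponent (scale_non_one_one \<epsilon> N) / \<epsilon>"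
    using pos by eventually_elim (simp add: u)
  ultimately show ?thesis
    by (auto simp: \<kappa>_def elim: Lim_transform_eventually)
qed

theorem lemma3p1:
  fixes N :: "('s::finite, 'r) network"
  assumes "wf_network N"
  shows "(\<forall>v. normalized_lyapunov_eigenvector N v \<longrightarrow>
            lyapunov_exponent N = (\<Sum>\<sigma>\<in>UNIV. deficiency_rate N \<sigma> * v $ \<sigma>)) \<and>
         (\<forall>\<pi>. irreducible_chain (one_one_rate N) \<and>
            stationary_distribution (one_one_rate N) \<pi> \<and>
            (\<forall>\<pi>'. stationary_distribution (one_one_rate N) \<pi>' \<longrightarrow> \<pi>' = \<pi>) \<and>
            detailed_balanced (one_one_rate N) \<pi> \<longrightarrow>
            ((\<lambda>\<epsilon>. lyapunov_exponent (scale_non_one_one \<epsilon> N) / \<epsilon>)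
               \<longlongrightarrow> (\<Sum>\<sigma>\<in>UNIV. deficiency_rate N \<sigma> * \<pi> \<sigma>)) (at_right 0))"
  using eigenvalue_eq_sum_deficiency[OF assms] lyapunov_exponent_scaling_limit[OF assms]
  by (auto simp: normalized_lyapunov_eigenvector_def)

end
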